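(* Let $\pi_q$ be a projective plane of order $q$. Then $G_n\hookrightarrow\pi_q$ for all integers $n$ with $3\le n\le q$.
   Context: Graphs are simple, finite and undirected. The gear graph $G_n$ (for an integer $n\ge 3$) is the graph on $2n+1$ vertices with $3n$ edges consisting of a $2n$-cycle $x_1x_2\cdots x_{2n}x_1$ together with one additional vertex, the center, that is adjacent to every second vertex of the cycle, i.e. exactly to $x_1,x_3,\dots,x_{2n-1}$ (so the center has degree $n$). A (finite) projective plane of order $q$ is an arbitrary one, not necessarily Desarguesian: it has $q^2+q+1$ points and $q^2+q+1$ lines, every line contains $q+1$ points, and every point is incident with $q+1$ lines. An embedding of a graph $G=(V,E)$ into a plane with point set $\mathcal{P}$ and line set $\mathcal{L}$ is an injective function $\psi:V\to\mathcal{P}$ such that the induced map $\overline{\psi}:E\to\mathcal{L}$, sending an edge $uv$ to the unique line through $\psi(u)$ and $\psi(v)$, is also injective (different edges use different whole lines). If such a $\psi$ exists, $G$ embeds in the plane; this is denoted by $\hookrightarrow$. *)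

theory Defs
  imports Main
begin

type_synonym 'v graph = "'v set \<times> 'v set set"

definition simple_graph :: "'v graph \<Rightarrow> bool" where
  "simple_graph G \<longleftrightarrow> finite (fst G) \<and> (\<forall>e\<in>snd G. e \<subseteq> fst G \<and> card e = 2)"


datatype gear_vertex = Center | Rim nat

definition gear_verts :: "nat \<Rightarrow> gear_vertex set" where
  "gear_verts n = insert Center (Rim ` {1..2 * n})"

definition gear_cycle_edges :: "nat \<Rightarrow> gear_vertex set set" where
  "gear_cycle_edges n =
     insert {Rim (2 * n), Rim 1} ((\<lambda>i. {Rim i, Rim (i + 1)}) ` {1..<2 * n})"

definition gear_spokes :: "nat \<Rightarrow> gear_vertex set set" where
  "gear_spokes n = (\<lambda>i. {Center, Rim i}) ` {i \<in> {1..2 * n}. odd i}"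

definition gear_graph :: "nat \<Rightarrow> gear_vertex graph" where
  "gear_graph n = (gear_verts n, gear_cycle_edges n \<union> gear_spokes n)"


locale projective_plane =
  fixes P :: "'p set" and L :: "'l set" and incident :: "'p \<Rightarrow> 'l \<Rightarrow> bool"
  assumes unique_line:
      "\<lbrakk>x \<in> P; y \<in> P; x \<noteq> y\<rbrakk> \<Longrightarrow> \<exists>!l. l \<in> L \<and> incident x l \<and> incident y l"
    and unique_point:
      "\<lbrakk>l \<in> L; m \<in> L; l \<noteq> m\<rbrakk> \<Longrightarrow> \<exists>!x. x \<in> P \<and> incident x l \<and> incident x m"
    and quadrangle:
      "\<exists>Q\<subseteq>P. card Q = 4 \<and> (\<forall>l\<in>L. card {x \<in> Q. incident x l} \<le> 2)"

(* The four counts are not independent: for a finite plane each of them follows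
   from the axioms and the number of points on one line. *)
locale projective_plane_of_order = projective_plane P L incident
  for P :: "'p set" and L :: "'l set" and incident :: "'p \<Rightarrow> 'l \<Rightarrow> bool" +
  fixes q :: nat
  assumes card_points: "card P = q\<^sup>2 + q + 1"
    and card_lines: "card L = q\<^sup>2 + q + 1"
    and card_points_on_line: "l \<in> L \<Longrightarrow> card {x \<in> P. incident x l} = q + 1"
    and card_lines_through_point: "x \<in> P \<Longrightarrow> card {l \<in> L. incident x l} = q + 1"


(* For an edge e = {u, v} with psi u and psi v distinct points of a projective plane,
   this is the unique line through psi u and psi v. *)
definition induced_line ::
  "'l set \<Rightarrow> ('p \<Rightarrow> 'l \<Rightarrow> bool) \<Rightarrow> ('v \<Rightarrow> 'p) \<Rightarrow> 'v set \<Rightarrow> 'l" where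
  "induced_line L incident \<psi> e = (THE l. l \<in> L \<and> (\<forall>v\<in>e. incident (\<psi> v) l))"

definition is_embedding ::
  "'v graph \<Rightarrow> 'p set \<Rightarrow> 'l set \<Rightarrow> ('p \<Rightarrow> 'l \<Rightarrow> bool) \<Rightarrow> ('v \<Rightarrow> 'p) \<Rightarrow> bool" where
  "is_embedding G P L incident \<psi> \<longleftrightarrow>
     \<psi> ` fst G \<subseteq> P \<and> inj_on \<psi> (fst G) \<and> inj_on (induced_line L incident \<psi>) (snd G)"

definition embeds ::
  "'v graph \<Rightarrow> 'p set \<Rightarrow> 'l set \<Rightarrow> ('p \<Rightarrow> 'l \<Rightarrow> bool) \<Rightarrow> bool" where
  "embeds G P L incident \<longleftrightarrow> (\<exists>\<psi>. is_embedding G P L incident \<psi>)"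


lemma (in projective_plane) induced_line_eq:
  assumes "\<psi> u \<in> P" "\<psi> v \<in> P" "\<psi> u \<noteq> \<psi> v" "l \<in> L" "incident (\<psi> u) l" "incident (\<psi> v) l"
  shows "induced_line L incident \<psi> {u, v} = l"
  unfolding induced_line_def
proof (rule the_equality)
  show "l \<in> L \<and> (\<forall>w\<in>{u, v}. incident (\<psi> w) l)"
    using assms(4-6) by simp
next
  fix m
  assume "m \<in> L \<and> (\<forall>w\<in>{u, v}. incident (\<psi> w) m)"
  then have "m \<in> L \<and> incident (\<psi> u) m \<and> incident (\<psi> v) m" by simp
  then show "m = l"
    using unique_line[OF assms(1-3)] assms(4-6) by blast
qed

lemma simple_graph_gear_graph:
  assumes "1 \<le> n"
  shows "simple_graph (gear_graph n)"
  using assms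
  by (auto simp: simple_graph_def gear_graph_def gear_verts_def gear_cycle_edges_def
      gear_spokes_def)

lemma card_gear_verts: "card (fst (gear_graph n)) = 2 * n + 1"
proof -
  have "card (Rim ` {1..2 * n}) = 2 * n"
    by (subst card_image) (auto simp: inj_on_def)
  moreover have "Center \<notin> Rim ` {1..2 * n}" by auto
  ultimately show ?thesis by (simp add: gear_graph_def gear_verts_def)
qed

lemma card_gear_edges:
  assumes "3 \<le> n"
  shows "card (snd (gear_graph n)) = 3 * n"
proof -
  have "inj_on (\<lambda>i. {Rim i, Rim (i + 1)}) {1..<2 * n}"
  proof (rule inj_onI)
    fix i j
    assume "{Rim i, Rim (i + 1)} = {Rim j, Rim (j + 1)}"
    then have "i = j \<or> i = j + 1 \<and> i + 1 = j"
      unfolding doubleton_eq_iff gear_vertex.inject by blast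
    then show "i = j" by linarith
  qed
  then have "card ((\<lambda>i. {Rim i, Rim (i + 1)}) ` {1..<2 * n}) = 2 * n - 1"
    by (simp add: card_image)
  moreover have "{Rim (2 * n), Rim 1} \<notin> (\<lambda>i. {Rim i, Rim (i + 1)}) ` {1..<2 * n}"
  proof
    assume "{Rim (2 * n), Rim 1} \<in> (\<lambda>i. {Rim i, Rim (i + 1)}) ` {1..<2 * n}"
    then obtain i where i: "i \<in> {1..<2 * n}" "{Rim (2 * n), Rim 1} = {Rim i, Rim (i + 1)}"
      by (rule imageE)
    from i(1) have "i < 2 * n" by simp
    moreover from i(2) have "2 * n = i \<or> 1 = i \<and> 2 * n = i + 1"
      unfolding doubleton_eq_iff gear_vertex.inject by blast
    ultimately show False using assms by linarith
  qed
  ultimately have c: "card (gear_cycle_edges n) = 2 * n"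
    using assms by (simp add: gear_cycle_edges_def)
  have "{i \<in> {1..2 * n}. odd i} = (\<lambda>k. 2 * k + 1) ` {..<n}"
  proof (intro equalityI subsetI)
    fix i assume "i \<in> {i \<in> {1..2 * n}. odd i}"
    then have "i = 2 * (i div 2) + 1" "i \<le> 2 * n" by auto
    then have "i = 2 * (i div 2) + 1" "i div 2 < n" by linarith+
    then show "i \<in> (\<lambda>k. 2 * k + 1) ` {..<n}" by blast
  qed auto
  then have "card {i \<in> {1..2 * n}. odd i} = n"
    by (simp add: card_image inj_on_def)
  then have s: "card (gear_spokes n) = n"
    unfolding gear_spokes_def by (subst card_image) (auto simp: inj_on_def doubleton_eq_iff)
  have "gear_cycle_edges n \<inter> gear_spokes n = {}"
    by (auto simp: gear_cycle_edges_def gear_spokes_def doubleton_eq_iff)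
  moreover have "finite (gear_cycle_edges n)" "finite (gear_spokes n)"
    by (auto simp: gear_cycle_edges_def gear_spokes_def)
  ultimately show ?thesis
    using c s by (simp add: gear_graph_def card_Un_disjoint)
qed

end

theory Submission
  imports Defs
begin

text \<open>
  Take two lines \<open>M\<close>, \<open>N\<close> meeting in a point \<open>z\<close>, and a point \<open>c\<close> on neither of them. The
  \<open>q\<close> lines through \<open>c\<close> that miss \<open>z\<close> meet \<open>M\<close> in points \<open>y\<^sub>0, \<dots>, y\<^sub>q\<^sub>-\<^sub>1\<close> and \<open>N\<close> in points
  \<open>p\<^sub>0, \<dots>, p\<^sub>q\<^sub>-\<^sub>1\<close>, where \<open>y\<^sub>i\<close> and \<open>p\<^sub>i\<close> correspond under the perspectivity with centre \<open>c\<close>.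
  A line joining \<open>y\<^sub>i\<close> to \<open>p\<^sub>j\<close> meets \<open>M\<close> only in \<open>y\<^sub>i\<close> and \<open>N\<close> only in \<open>p\<^sub>j\<close>, so it determines
  the pair \<open>(i, j)\<close>; and it avoids \<open>c\<close> as soon as \<open>i \<noteq> j\<close> (\<open>perspective_ranges\<close>).

  Hence every injective choice of indices gives an embedding, with the centre at \<open>c\<close>, the
  vertices of degree three among the \<open>y\<^sub>i\<close> and those of degree two among the \<open>p\<^sub>j\<close>, provided
  that no edge of the cycle joins a \<open>y\<^sub>i\<close> to its own partner \<open>p\<^sub>i\<close>. With indices modulo \<open>n\<close>
  the cycle \<open>\<dots>, y\<^sub>i, p\<^sub>i\<^sub>+\<^sub>2, y\<^sub>i\<^sub>+\<^sub>1, p\<^sub>i\<^sub>+\<^sub>3, \<dots>\<close> satisfies this: \<open>i + 2\<close> differs from both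
  \<open>i\<close> and \<open>i + 1\<close> because \<open>n \<ge> 3\<close>. The bound \<open>n \<le> q\<close> is the number of available indices.
\<close>

context projective_plane
begin

lemma line_eqI:
  assumes "x \<in> P" "y \<in> P" "x \<noteq> y" "l \<in> L" "m \<in> L"
    and "incident x l" "incident y l" "incident x m" "incident y m"
  shows "l = m"
  using unique_line[OF assms(1-3)] assms(4-9) by blast

lemma point_eqI:
  assumes "l \<in> L" "m \<in> L" "l \<noteq> m" "x \<in> P" "y \<in> P"
    and "incident x l" "incident x m" "incident y l" "incident y m"
  shows "x = y"
  using unique_point[OF assms(1-3)] assms(4-9) by blast

text \<open>
  This replaces the definite description in the induced line by collinearity: two edges induce
  the same line exactly when all their end points lie on one line.
\<close>

lemma is_embeddingI:
  assumes G: "simple_graph G"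
    and P: "\<psi> ` fst G \<subseteq> P" and inj: "inj_on \<psi> (fst G)"
    and not_collinear: "\<And>e f l. \<lbrakk>e \<in> snd G; f \<in> snd G; e \<noteq> f; l \<in> L;
                          \<forall>v\<in>e \<union> f. incident (\<psi> v) l\<rbrakk> \<Longrightarrow> False"
  shows "is_embedding G P L incident \<psi>"
proof -
  have line: "induced_line L incident \<psi> e \<in> L \<and>
      (\<forall>v\<in>e. incident (\<psi> v) (induced_line L incident \<psi> e))" if e: "e \<in> snd G" for e
  proof -
    have "e \<subseteq> fst G" "card e = 2" using G e by (auto simp: simple_graph_def)
    then obtain u v where uv: "e = {u, v}" "u \<noteq> v" "u \<in> fst G" "v \<in> fst G"
      by (auto simp: card_2_iff)
    then have d: "\<psi> u \<in> P" "\<psi> v \<in> P" "\<psi> u \<noteq> \<psi> v"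
      using P inj by (auto simp: inj_on_def)
    then obtain l where l: "l \<in> L" "incident (\<psi> u) l" "incident (\<psi> v) l"
      using unique_line by blast
    with d have "induced_line L incident \<psi> {u, v} = l"
      by (intro induced_line_eq)
    with l uv(1) show ?thesis by simp
  qed
  have "inj_on (induced_line L incident \<psi>) (snd G)"
  proof (rule inj_onI, rule ccontr)
    fix e f
    assume ef: "e \<in> snd G" "f \<in> snd G" "e \<noteq> f"
      and eq: "induced_line L incident \<psi> e = induced_line L incident \<psi> f"
    show False
      using not_collinear[OF ef, of "induced_line L incident \<psi> e"] line[OF ef(1)] line[OF ef(2)]
      by (auto simp: eq)
  qed
  with P inj show ?thesis by (simp add: is_embedding_def)
qed

end

text \<open>
  These are the two ranges of a perspectivity with centre \<open>c\<close> between lines \<open>M\<close> and \<open>N\<close>,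
  without the point where \<open>M\<close> and \<open>N\<close> meet. Two points \<open>y i\<close> span \<open>M\<close>, which contains
  neither \<open>c\<close> nor any \<open>p j\<close>; two points \<open>p j\<close> span \<open>N\<close>, which contains no \<open>y i\<close>; and a line
  through \<open>c\<close> meets \<open>M\<close> and \<open>N\<close> in corresponding points. The last four conclusions express
  this as non-collinearity of triples.
\<close>

lemma (in projective_plane_of_order) perspective_ranges:
  assumes q: "2 \<le> q"
  obtains c :: 'p and y p :: "nat \<Rightarrow> 'p" where
    "c \<in> P" "\<And>i. i < q \<Longrightarrow> y i \<in> P" "\<And>i. i < q \<Longrightarrow> p i \<in> P"
    "\<And>i. i < q \<Longrightarrow> y i \<noteq> c" "\<And>i. i < q \<Longrightarrow> p i \<noteq> c"
    "\<And>i j. \<lbrakk>i < q; j < q\<rbrakk> \<Longrightarrow> y i \<noteq> p j"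
    "inj_on y {..<q}" "inj_on p {..<q}"
    "\<And>i j l. \<lbrakk>i < q; j < q; i \<noteq> j; l \<in> L; incident c l; incident (y i) l\<rbrakk>
       \<Longrightarrow> \<not> incident (y j) l"
    "\<And>i j l. \<lbrakk>i < q; j < q; i \<noteq> j; l \<in> L; incident c l; incident (y i) l\<rbrakk>
       \<Longrightarrow> \<not> incident (p j) l"
    "\<And>i j k l. \<lbrakk>i < q; j < q; k < q; i \<noteq> k; l \<in> L; incident (y i) l; incident (y k) l\<rbrakk>
       \<Longrightarrow> \<not> incident (p j) l"
    "\<And>i j k l. \<lbrakk>i < q; j < q; k < q; j \<noteq> k; l \<in> L; incident (p j) l; incident (p k) l\<rbrakk>
       \<Longrightarrow> \<not> incident (y i) l"
proof -
  have "2 \<le> card L" using q by (simp add: card_lines)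
  then obtain M N where MN: "M \<in> L" "N \<in> L" "M \<noteq> N"
    by (auto simp: card_le_Suc_iff numeral_2_eq_2)
  then obtain z where z: "z \<in> P" "incident z M" "incident z N"
    using unique_point by blast
  have fin: "finite P" by (rule card_ge_0_finite) (simp add: card_points)
  have "\<exists>c\<in>P. \<not> incident c M \<and> \<not> incident c N"
  proof (rule ccontr)
    assume "\<not> ?thesis"
    then have "P = {x \<in> P. incident x M} \<union> {x \<in> P. incident x N}" by blast
    then have "card P \<le> (q + 1) + (q + 1)"
      by (metis card_Un_le card_points_on_line MN(1,2))
    moreover have "2 * q \<le> q\<^sup>2" using q by (simp add: power2_eq_square)
    ultimately show False using q by (simp add: card_points)
  qed
  then obtain c where c: "c \<in> P" "\<not> incident c M" "\<not> incident c N" by blast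
  have "card ({x \<in> P. incident x M} - {z}) = q"
    using z MN fin by (simp add: card_points_on_line)
  then obtain y where y: "bij_betw y {..<q} ({x \<in> P. incident x M} - {z})"
    using ex_bij_betw_nat_finite[of "{x \<in> P. incident x M} - {z}"] fin
    by (auto simp: atLeast0LessThan)
  then have yM: "y i \<in> P" "incident (y i) M" "y i \<noteq> z" if "i < q" for i
    using bij_betwE[OF y] that by auto
  have y_inj: "inj_on y {..<q}" using y by (rule bij_betw_imp_inj_on)
  have yc: "y i \<noteq> c" if "i < q" for i using yM[OF that] c by auto
  have "\<exists>x l. x \<in> P \<and> l \<in> L \<and> incident x N \<and> incident x l \<and> incident c l \<and> incident (y i) l"
    if i: "i < q" for i
  proof -
    obtain l where l: "l \<in> L" "incident c l" "incident (y i) l"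
      using unique_line[OF c(1) yM(1)[OF i]] yc[OF i] by blast
    with c have "l \<noteq> N" by blast
    with l MN(2) show ?thesis using unique_point[of l N] by blast
  qed
  then have "\<forall>i\<in>{..<q}. \<exists>xl. fst xl \<in> P \<and> snd xl \<in> L \<and> incident (fst xl) N \<and>
      incident (fst xl) (snd xl) \<and> incident c (snd xl) \<and> incident (y i) (snd xl)"
    by simp
  then obtain pl where pl: "\<forall>i\<in>{..<q}. fst (pl i) \<in> P \<and> snd (pl i) \<in> L \<and>
      incident (fst (pl i)) N \<and> incident (fst (pl i)) (snd (pl i)) \<and>
      incident c (snd (pl i)) \<and> incident (y i) (snd (pl i))"
    unfolding bchoice_iff by blast
  define p l where "p i = fst (pl i)" and "l i = snd (pl i)" for i
  then have p: "p i \<in> P" "l i \<in> L" "incident (p i) N" "incident (p i) (l i)"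
      "incident c (l i)" "incident (y i) (l i)" if "i < q" for i
    using pl that by simp_all
  have pc: "p i \<noteq> c" if "i < q" for i using p(3)[OF that] c by auto
  have yN: "\<not> incident (y i) N" if "i < q" for i
    using point_eqI[of M N "y i" z] MN z yM[OF that] by blast
  have pM: "\<not> incident (p i) M" if i: "i < q" for i
  proof
    assume "incident (p i) M"
    with MN z p(1,3)[OF i] have "p i = z" by (intro point_eqI[of M N "p i" z])
    then have "l i = M"
      using line_eqI[of z "y i" "l i" M] z MN(1) p[OF i] yM[OF i] by metis
    with p(5)[OF i] c(2) show False by simp
  qed
  have cyy: "\<not> incident (y j) m"
    if "i < q" "j < q" "i \<noteq> j" "m \<in> L" "incident c m" "incident (y i) m" for i j m
  proof
    assume "incident (y j) m"
    moreover have "y i \<noteq> y j" using that y_inj by (auto simp: inj_on_def)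
    ultimately have "m = M"
      using line_eqI[of "y i" "y j" m M] MN(1) yM that by blast
    with that(5) c(2) show False by simp
  qed
  have cyp: "\<not> incident (p j) m"
    if "i < q" "j < q" "i \<noteq> j" "m \<in> L" "incident c m" "incident (y i) m" for i j m
  proof
    assume "incident (p j) m"
    then have "m = l j"
      using line_eqI[of c "p j" m "l j"] c(1) pc[OF that(2)] p[OF that(2)] that by metis
    with p(6)[OF that(2)] cyy[OF that] show False by simp
  qed
  have yyp: "\<not> incident (p j) m"
    if "i < q" "j < q" "k < q" "i \<noteq> k" "m \<in> L" "incident (y i) m" "incident (y k) m" for i j k m
  proof -
    have "y i \<noteq> y k" using that y_inj by (auto simp: inj_on_def)
    then have "m = M"
      using line_eqI[of "y i" "y k" m M] MN(1) yM that by blast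
    with pM that show ?thesis by simp
  qed
  have p_inj: "inj_on p {..<q}"
  proof (rule inj_onI, rule ccontr)
    fix i j assume ij: "i \<in> {..<q}" "j \<in> {..<q}" "p i = p j" "i \<noteq> j"
    then show False using cyp[of i j "l i"] p[of i] by auto
  qed
  have ypp: "\<not> incident (y i) m"
    if "i < q" "j < q" "k < q" "j \<noteq> k" "m \<in> L" "incident (p j) m" "incident (p k) m" for i j k m
  proof -
    have "p j \<noteq> p k" using that p_inj by (auto simp: inj_on_def)
    then have "m = N"
      using line_eqI[of "p j" "p k" m N] MN(2) p that by blast
    with yN that show ?thesis by simp
  qed
  have yp: "y i \<noteq> p j" if "i < q" "j < q" for i j
    using yM(2)[OF that(1)] pM[OF that(2)] by auto
  show thesis
    by (rule that[of c y p]) (fact c(1) yM(1) p(1) yc pc yp y_inj p_inj cyy cyp yyp ypp)+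
qed

text \<open>
  Counting the vertices of the two kinds separately from zero, the \<open>j\<close>-th vertex of degree two
  lies between the vertices of degree three numbered \<open>j\<close> and \<open>j + 1\<close> modulo \<open>n\<close>.
\<close>

lemma gear_edge_cases:
  assumes "e \<in> snd (gear_graph n)" and n: "1 \<le> n"
  obtains (spoke) i where "i < n" "e = {Center, Rim (2 * i + 1)}"
    | (rim) i j where "i < n" "j < n" "i = j \<or> i = (j + 1) mod n"
        "e = {Rim (2 * i + 1), Rim (2 * j + 2)}"
proof -
  consider (last) "e = {Rim (2 * n), Rim 1}"
    | (cycle) k where "1 \<le> k" "k < 2 * n" "e = {Rim k, Rim (k + 1)}"
    | (centre) k where "1 \<le> k" "k \<le> 2 * n" "odd k" "e = {Center, Rim k}"
    using assms(1) by (auto simp: gear_graph_def gear_cycle_edges_def gear_spokes_def)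
  then show thesis
  proof cases
    case last
    then have "e = {Rim (2 * 0 + 1), Rim (2 * (n - 1) + 2)}" using n by auto
    with n show thesis by (intro rim[of 0 "n - 1"]) simp_all
  next
    case cycle
    show thesis
    proof (cases "odd k")
      case True
      then obtain i where "k = 2 * i + 1" by (elim oddE)
      with cycle show thesis by (intro rim[of i i]) auto
    next
      case False
      then obtain i where "k = 2 * i" by auto
      with cycle have "k = 2 * (i - 1) + 2" "1 \<le> i" "i < n" by auto
      with cycle \<open>k = 2 * i\<close> show thesis by (intro rim[of i "i - 1"]) auto
    qed
  next
    case centre
    then obtain i where "k = 2 * i + 1" by (elim oddE)
    with centre show thesis by (intro spoke[of i]) auto
  qed
qed

lemma add_2_mod_neq:
  fixes i j n :: nat
  assumes "3 \<le> n" "j < n" "i = j \<or> i = (j + 1) mod n"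
  shows "i \<noteq> (j + 2) mod n"
proof -
  have "(j + 1) mod n = (if j + 1 < n then j + 1 else j + 1 - n)"
    "(j + 2) mod n = (if j + 2 < n then j + 2 else j + 2 - n)"
    using assms(1,2) by (auto simp: le_mod_geq)
  with assms show ?thesis by (auto split: if_splits)
qed

lemma add_2_mod_inj:
  fixes i j n :: nat
  assumes "(i + 2) mod n = (j + 2) mod n" "i < n" "j < n"
  shows "i = j"
proof (cases "i \<le> j")
  case True
  with assms have "n dvd j - i" using mod_eq_dvd_iff_nat[of "i + 2" "j + 2" n] by simp
  with assms True show ?thesis by (auto dest: dvd_imp_le)
next
  case False
  with assms have "n dvd i - j" using mod_eq_dvd_iff_nat[of "j + 2" "i + 2" n] by simp
  with assms False show ?thesis by (auto dest: dvd_imp_le)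
qed

theorem theorem5:
  fixes P :: "'p set" and L :: "'l set" and incident :: "'p \<Rightarrow> 'l \<Rightarrow> bool" and q n :: nat
  assumes "projective_plane_of_order P L incident q"
    and "3 \<le> n" and "n \<le> q"
  shows "embeds (gear_graph n) P L incident"
proof -
  interpret projective_plane_of_order P L incident q by fact
  note n = assms(2,3)
  have "2 \<le> q" using n by simp
  obtain c y p where
    P: "c \<in> P" "\<And>i. i < q \<Longrightarrow> y i \<in> P" "\<And>i. i < q \<Longrightarrow> p i \<in> P"
    and neq: "\<And>i. i < q \<Longrightarrow> y i \<noteq> c" "\<And>i. i < q \<Longrightarrow> p i \<noteq> c"
      "\<And>i j. \<lbrakk>i < q; j < q\<rbrakk> \<Longrightarrow> y i \<noteq> p j"
    and inj: "inj_on y {..<q}" "inj_on p {..<q}"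
    and cyy: "\<And>i j l. \<lbrakk>i < q; j < q; i \<noteq> j; l \<in> L; incident c l; incident (y i) l\<rbrakk>
       \<Longrightarrow> \<not> incident (y j) l"
    and cyp: "\<And>i j l. \<lbrakk>i < q; j < q; i \<noteq> j; l \<in> L; incident c l; incident (y i) l\<rbrakk>
       \<Longrightarrow> \<not> incident (p j) l"
    and yyp: "\<And>i j k l. \<lbrakk>i < q; j < q; k < q; i \<noteq> k; l \<in> L; incident (y i) l; incident (y k) l\<rbrakk>
       \<Longrightarrow> \<not> incident (p j) l"
    and ypp: "\<And>i j k l. \<lbrakk>i < q; j < q; k < q; j \<noteq> k; l \<in> L; incident (p j) l; incident (p k) l\<rbrakk>
       \<Longrightarrow> \<not> incident (y i) l"
    by (rule perspective_ranges[OF \<open>2 \<le> q\<close>]) (rule that)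
  define s where "s j = (j + 2) mod n" for j
  have s: "s j < q" for j using n mod_less_divisor[of n "j + 2"] unfolding s_def by linarith
  have s_inj: "i = j" if "s i = s j" "i < n" "j < n" for i j
    using add_2_mod_inj[of i n j] that unfolding s_def by blast
  \<comment> \<open>An even \<open>k = 2 * j + 2\<close> has \<open>k div 2 + 1 = j + 2\<close>.\<close>
  define \<psi> where "\<psi> v = (case v of Center \<Rightarrow> c
    | Rim k \<Rightarrow> if odd k then y (k div 2) else p ((k div 2 + 1) mod n))" for v
  have \<psi>: "\<psi> Center = c" "\<psi> (Rim (2 * i + 1)) = y i" "\<psi> (Rim (2 * i + 2)) = p (s i)" for i
    by (simp_all add: \<psi>_def s_def)
  have vertex: "v = Center \<or> (\<exists>i<n. v = Rim (2 * i + 1)) \<or> (\<exists>i<n. v = Rim (2 * i + 2))"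
    if "v \<in> fst (gear_graph n)" for v
  proof (cases v)
    case (Rim k)
    with that have k: "1 \<le> k" "k \<le> 2 * n" by (auto simp: gear_graph_def gear_verts_def)
    show ?thesis
    proof (cases "odd k")
      case True
      with k have "k = 2 * (k div 2) + 1" "k div 2 < n" by (auto elim!: oddE)
      with Rim show ?thesis by metis
    next
      case False
      with k have "k = 2 * (k div 2 - 1) + 2" "k div 2 - 1 < n" by (auto elim!: evenE)
      with Rim show ?thesis by metis
    qed
  qed simp
  have less_q: "i < q" if "i < n" for i using that n by simp
  have y_eq: "i = j" if "y i = y j" "i < n" "j < n" for i j
    using inj(1) that less_q by (auto simp: inj_on_def)
  have p_eq: "i = j" if "p (s i) = p (s j)" "i < n" "j < n" for i j
    using inj(2) that s s_inj by (auto simp: inj_on_def)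
  have "is_embedding (gear_graph n) P L incident \<psi>"
  proof (rule is_embeddingI)
    show "simple_graph (gear_graph n)" using n by (simp add: simple_graph_gear_graph)
    show "\<psi> ` fst (gear_graph n) \<subseteq> P"
    proof (rule image_subsetI)
      fix v assume "v \<in> fst (gear_graph n)"
      from vertex[OF this] show "\<psi> v \<in> P"
        using P s less_q by (elim disjE exE conjE) (simp_all only: \<psi>)
    qed
    show "inj_on \<psi> (fst (gear_graph n))"
    proof (rule inj_onI)
      fix u v assume uv: "u \<in> fst (gear_graph n)" "v \<in> fst (gear_graph n)" "\<psi> u = \<psi> v"
      from vertex[OF uv(1)] vertex[OF uv(2)] uv(3) show "u = v"
        using neq s less_q neq(1)[symmetric] neq(2)[symmetric] neq(3)[symmetric]
        by (elim disjE exE conjE; simp only: \<psi>) (auto dest: y_eq p_eq)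
    qed
  next
    fix e f l
    assume ef: "e \<in> snd (gear_graph n)" "f \<in> snd (gear_graph n)" "e \<noteq> f"
      and l: "l \<in> L" "\<forall>v\<in>e \<union> f. incident (\<psi> v) l"
    \<comment> \<open>An edge of the cycle avoids corresponding points of the two ranges.\<close>
    have rim_neq: "i \<noteq> s j" if "j < n" "i = j \<or> i = (j + 1) mod n" for i j
      unfolding s_def using add_2_mod_neq[OF n(1) that] .
    have spoke_rim: False
      if "i < n" "j < n" "k < n" "j = k \<or> j = (k + 1) mod n"
        "incident c l" "incident (y i) l" "incident (y j) l" "incident (p (s k)) l" for i j k
      using cyy[OF less_q less_q, of i j l] cyp[OF less_q s, of i k l] rim_neq[OF that(3,4)] l(1) that
      by auto
    have n1: "1 \<le> n" using n by simp
    from ef(1) n1 show False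
    proof (cases rule: gear_edge_cases)
      case e: (spoke i)
      from ef(2) n1 show False
      proof (cases rule: gear_edge_cases)
        case f: (spoke j)
        have "i \<noteq> j" using e f ef(3) by auto
        with cyy[of i j l] e f l show False by (simp add: \<psi>[simplified] less_q)
      next
        case f: (rim j k)
        with spoke_rim[of i j k] e l show False by (simp add: \<psi>[simplified])
      qed
    next
      case e: (rim i j)
      from ef(2) n1 show False
      proof (cases rule: gear_edge_cases)
        case f: (spoke k)
        with spoke_rim[of k i j] e l show False by (simp add: \<psi>[simplified])
      next
        case f: (rim k m)
        have "i \<noteq> k \<or> s j \<noteq> s m" using e f ef(3) s_inj by auto
        with yyp[of i "s j" k l] ypp[of i "s j" "s m" l] e f l s show False
          by (auto simp: \<psi>[simplified] less_q)
      qed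
    qed
  qed
  then show ?thesis by (auto simp: embeds_def)
qed

end
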